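(* For every positive integer $n$ divisible by $4$, there exist an $n$-dimensional acyclic unique sink orientation (AUSO) $\psi$ of the hypercube $Q^n$ and a starting vertex $v_0\in Q^n$ such that Johnson's least-recently basic rule (with ties broken by the fixed order $\prec$ described in the context), started at $v_0$, takes a path of length at least $2^{n/4}$ (i.e. makes at least $2^{n/4}$ steps) before reaching the global sink of $\psi$.
   Context: The $n$-dimensional hypercube $Q^n$ has vertex set $2^{[n]}$, with $u,v$ adjacent iff $|u\oplus v|=1$; the edge between $v$ and $v\oplus\{j\}$ is on coordinate $j$. A face is $F(C,v)=\{u: u\oplus v\subseteq C\}$. A unique sink orientation (USO) is an orientation of the edges of $Q^n$ such that every nonempty face has exactly one sink (vertex with no outgoing edges inside the face); an AUSO is an acyclic USO; the global sink is the unique vertex with no outgoing edges. A direction is a signed coordinate $\pm c$; at $v$, $+c$ refers to the edge to $v\cup\{c\}$ ($c\notin v$) and $-c$ to the edge to $v\setminus\{c\}$ ($c\in v$); it is available at $v$ if that edge exists and is outgoing from $v$. Johnson's least-recently basic rule: let $v_0,v_1,\dots,v_x$ be the vertices visited so far ($v_y$ is the vertex after step $y$). Before step $x+1$, define for each coordinate $c$: $h(+c)=\max(\{0\}\cup\{y\in\{1,\dots,x\}: c\in v_{y-1}\text{ or } c\in v_y\})$ and $h(-c)=\max(\{0\}\cup\{y\in\{1,\dots,x\}: c\notin v_{y-1}\text{ or } c\notin v_y\})$ (so $h(d)$ is the last step at which the coordinate was in the state that the opposite direction $-d$ leaves behind, i.e. the direction left the basis least recently). If $v_x$ is not the global sink,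 the rule moves along the available direction $d$ minimizing $h(d)$, breaking ties by the order $\prec$: writing $n=4m$ and grouping coordinates into bundles $\{4j+1,4j+2,4j+3,4j+4\}$ for $j=0,\dots,m-1$, directions of bundle $j$ precede those of bundle $j'$ whenever $j<j'$, and within bundle $j$ the order is $+(4j+1)\prec+(4j+2)\prec+(4j+3)\prec+(4j+4)\prec-(4j+1)\prec-(4j+2)\prec-(4j+3)\prec-(4j+4)$. *)

theory Defs
  imports Main
begin

definition cube :: "nat \<Rightarrow> nat set set" where
  "cube n = Pow {1..n}"

definition symdiff :: "nat set \<Rightarrow> nat set \<Rightarrow> nat set" where
  "symdiff u v = (u - v) \<union> (v - u)"

definition flip :: "nat set \<Rightarrow> nat \<Rightarrow> nat set" where
  "flip v j = symdiff v {j}"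

definition face :: "nat \<Rightarrow> nat set \<Rightarrow> nat set \<Rightarrow> nat set set" where
  "face n C v = {u \<in> cube n. symdiff u v \<subseteq> C}"

text \<open>An orientation is given by out v j: the edge of v on coordinate j is outgoing from v.
  Consistency: each edge has exactly one direction.\<close>
definition is_orientation :: "nat \<Rightarrow> (nat set \<Rightarrow> nat \<Rightarrow> bool) \<Rightarrow> bool" where
  "is_orientation n out \<longleftrightarrow>
     (\<forall>v\<in>cube n. \<forall>j\<in>{1..n}. out v j \<longleftrightarrow> \<not> out (flip v j) j)"

definition is_face_sink :: "nat \<Rightarrow> (nat set \<Rightarrow> nat \<Rightarrow> bool) \<Rightarrow> nat set \<Rightarrow> nat set \<Rightarrow> nat set \<Rightarrow> bool" where
  "is_face_sink n out C v u \<longleftrightarrow> u \<in> face n C v \<and> (\<forall>j\<in>C. \<not> out u j)"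

definition is_USO :: "nat \<Rightarrow> (nat set \<Rightarrow> nat \<Rightarrow> bool) \<Rightarrow> bool" where
  "is_USO n out \<longleftrightarrow> is_orientation n out \<and>
     (\<forall>C. C \<subseteq> {1..n} \<longrightarrow> (\<forall>v\<in>cube n. \<exists>!u. is_face_sink n out C v u))"

definition edge_rel :: "nat \<Rightarrow> (nat set \<Rightarrow> nat \<Rightarrow> bool) \<Rightarrow> (nat set \<times> nat set) set" where
  "edge_rel n out = {(u, flip u j) | u j. u \<in> cube n \<and> j \<in> {1..n} \<and> out u j}"

definition is_AUSO :: "nat \<Rightarrow> (nat set \<Rightarrow> nat \<Rightarrow> bool) \<Rightarrow> bool" where
  "is_AUSO n out \<longleftrightarrow> is_USO n out \<and> acyclic (edge_rel n out)"

definition is_global_sink :: "nat \<Rightarrow> (nat set \<Rightarrow> nat \<Rightarrow> bool) \<Rightarrow> nat set \<Rightarrow> bool" where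
  "is_global_sink n out v \<longleftrightarrow> v \<in> cube n \<and> (\<forall>j\<in>{1..n}. \<not> out v j)"

datatype dir = Pos nat | Neg nat

definition available :: "nat \<Rightarrow> (nat set \<Rightarrow> nat \<Rightarrow> bool) \<Rightarrow> nat set \<Rightarrow> dir \<Rightarrow> bool" where
  "available n out v d = (case d of
      Pos c \<Rightarrow> c \<in> {1..n} \<and> c \<notin> v \<and> out v c
    | Neg c \<Rightarrow> c \<in> {1..n} \<and> c \<in> v \<and> out v c)"

fun move :: "nat set \<Rightarrow> dir \<Rightarrow> nat set" where
  "move v (Pos c) = insert c v"
| "move v (Neg c) = v - {c}"

text \<open>History vs = [v_0, ..., v_x]; h(d) as in the paper.\<close>
fun hval :: "nat set list \<Rightarrow> dir \<Rightarrow> nat" where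
  "hval vs (Pos c) = Max ({0} \<union> {y \<in> {1..length vs - 1}. c \<in> vs ! (y - 1) \<or> c \<in> vs ! y})"
| "hval vs (Neg c) = Max ({0} \<union> {y \<in> {1..length vs - 1}. c \<notin> vs ! (y - 1) \<or> c \<notin> vs ! y})"

text \<open>Tie-breaking order: bundles {4j+1,..,4j+4}; within a bundle
  +(4j+1) < ... < +(4j+4) < -(4j+1) < ... < -(4j+4).\<close>
fun rank :: "dir \<Rightarrow> nat" where
  "rank (Pos c) = 8 * ((c - 1) div 4) + (c - 1) mod 4"
| "rank (Neg c) = 8 * ((c - 1) div 4) + 4 + (c - 1) mod 4"

definition johnson_choice :: "nat \<Rightarrow> (nat set \<Rightarrow> nat \<Rightarrow> bool) \<Rightarrow> nat set list \<Rightarrow> dir" where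
  "johnson_choice n out vs = (THE d. available n out (last vs) d \<and>
     (\<forall>d'. available n out (last vs) d' \<and> d' \<noteq> d \<longrightarrow>
        hval vs d < hval vs d' \<or> (hval vs d = hval vs d' \<and> rank d < rank d')))"

definition johnson_next :: "nat \<Rightarrow> (nat set \<Rightarrow> nat \<Rightarrow> bool) \<Rightarrow> nat set list \<Rightarrow> nat set" where
  "johnson_next n out vs =
     (if is_global_sink n out (last vs) then last vs
      else move (last vs) (johnson_choice n out vs))"

fun johnson_hist :: "nat \<Rightarrow> (nat set \<Rightarrow> nat \<Rightarrow> bool) \<Rightarrow> nat set \<Rightarrow> nat \<Rightarrow> nat set list" where
  "johnson_hist n out v0 0 = [v0]"
| "johnson_hist n out v0 (Suc x) =
     (let vs = johnson_hist n out v0 x in vs @ [johnson_next n out vs])"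

definition johnson_vertex :: "nat \<Rightarrow> (nat set \<Rightarrow> nat \<Rightarrow> bool) \<Rightarrow> nat set \<Rightarrow> nat \<Rightarrow> nat set" where
  "johnson_vertex n out v0 x = last (johnson_hist n out v0 x)"

end

(*
  The available direction at a coordinate has as its h-value the step of the last flip of that
  coordinate. Started at the empty set, Johnson's rule therefore keeps the coordinates in a list,
  initially 1, ..., n, always flips the first available coordinate of the list, and moves it to the
  back.

  It suffices to double the length of a run at the cost of three new coordinates, for arbitrary
  starting vertices and initial lists. Let A be an orientation with a long run, ending at its sink
  w with the list N, and let B be one with a long run started at w with the list N. Extend A by a
  three-dimensional frame, all of whose orientations (which may depend on the inner vertex) have the
  same sink f, and put B on the face over f. On the path of A the frame orientations are chosen such
  that the frame, before any inner coordinate gets its turn, either does not move or makes two moves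
  and returns to an equivalent position, so that it reaches f only after A has reached w. Then the
  run of B follows undisturbed.
*)

theory Submission
  imports Defs
begin

section \<open>Orientations over a coordinate set and the move-to-back rule\<close>

definition move_back :: "nat \<Rightarrow> nat list \<Rightarrow> nat list" where
  "move_back c L = remove1 c L @ [c]"

text \<open>The relation is partial: where no listed coordinate is outgoing there is no step, so the
  length of a run certifies how long the sink is avoided.\<close>

definition lru_step ::
    "(nat set \<Rightarrow> nat \<Rightarrow> bool) \<Rightarrow> nat set \<times> nat list \<Rightarrow> nat set \<times> nat list \<Rightarrow> bool" where
  "lru_step out s s' \<longleftrightarrow>
     (\<exists>c. find (out (fst s)) (snd s) = Some c \<and> s' = (flip (fst s) c, move_back c (snd s)))"

text \<open>The ground set \<open>S\<close> is a parameter because the construction recurses on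
  subsets of the coordinates.\<close>

definition szabo_welzl :: "nat set \<Rightarrow> (nat set \<Rightarrow> nat \<Rightarrow> bool) \<Rightarrow> bool" where
  "szabo_welzl S out \<longleftrightarrow>
     (\<forall>u v. u \<subseteq> S \<longrightarrow> v \<subseteq> S \<longrightarrow> u \<noteq> v \<longrightarrow> (\<exists>j\<in>symdiff u v. out u j \<noteq> out v j))"

text \<open>A certificate of acyclicity that can be combined arithmetically; it also shows that a
  run never revisits a vertex.\<close>

definition potential :: "nat set \<Rightarrow> (nat set \<Rightarrow> nat \<Rightarrow> bool) \<Rightarrow> (nat set \<Rightarrow> nat) \<Rightarrow> bool" where
  "potential S out p \<longleftrightarrow> (\<forall>v j. v \<subseteq> S \<longrightarrow> j \<in> S \<longrightarrow> out v j \<longrightarrow> p (flip v j) < p v)"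

lemma mem_symdiff [simp]: "c \<in> symdiff u v \<longleftrightarrow> (c \<in> u) \<noteq> (c \<in> v)"
  by (auto simp: symdiff_def)

lemma mem_flip [simp]: "c \<in> flip v j \<longleftrightarrow> (c \<in> v) \<noteq> (c = j)"
  by (auto simp: flip_def)

lemma symdiff_empty [simp]: "symdiff u {} = u"
  by auto

lemma symdiff_eq_empty [simp]: "symdiff u v = {} \<longleftrightarrow> u = v"
  by (auto simp: symdiff_def)

lemma symdiff_flip [simp]: "symdiff v (flip v j) = {j}"
  by auto

lemma flip_neq [simp]: "flip v j \<noteq> v"
  by (metis mem_flip)

lemma flip_subset: "v \<subseteq> S \<Longrightarrow> j \<in> S \<Longrightarrow> flip v j \<subseteq> S"
  by auto

subsection \<open>Unique sinks from the Szabo-Welzl condition\<close>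

lemma card_face:
  assumes "v \<in> cube n" "C \<subseteq> {1..n}"
  shows "card (face n C v) = card (Pow C)"
proof (rule bij_betw_same_card)
  show "bij_betw (\<lambda>u. symdiff u v) (face n C v) (Pow C)"
  proof (rule bij_betw_byWitness[where f' = "\<lambda>D. symdiff D v"])
    show "(\<lambda>D. symdiff D v) ` Pow C \<subseteq> face n C v"
    proof
      fix u assume "u \<in> (\<lambda>D. symdiff D v) ` Pow C"
      then obtain D where D: "D \<subseteq> C" "u = symdiff D v" by auto
      then have "u \<subseteq> {1..n}" using assms unfolding cube_def symdiff_def by blast
      moreover have "symdiff u v = D" using D by auto
      ultimately show "u \<in> face n C v" using D by (simp add: face_def cube_def)
    qed
  qed (auto simp: face_def)
qed

text \<open>On a face the outmaps are pairwise distinct and as many as the subsets of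
  \<open>C\<close>, so each subset, in particular \<open>{}\<close>, occurs exactly once.\<close>

lemma szabo_welzl_is_USO:
  assumes sw: "szabo_welzl {1..n} out"
  shows "is_USO n out"
  unfolding is_USO_def
proof (intro conjI allI impI ballI)
  show "is_orientation n out"
    unfolding is_orientation_def
  proof (intro ballI)
    fix v j assume "v \<in> cube n" "j \<in> {1..n}"
    then have "v \<subseteq> {1..n}" "flip v j \<subseteq> {1..n}" by (simp_all add: cube_def flip_subset)
    then have "\<exists>i\<in>symdiff v (flip v j). out v i \<noteq> out (flip v j) i"
      using sw flip_neq[of v j] unfolding szabo_welzl_def by metis
    then show "out v j \<longleftrightarrow> \<not> out (flip v j) j" by (auto simp del: mem_symdiff)
  qed
next
  fix C v assume C: "C \<subseteq> {1..n}" and v: "v \<in> cube n"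
  let ?F = "face n C v" and ?o = "\<lambda>u. {j\<in>C. out u j}"
  have inj: "inj_on ?o ?F"
  proof (rule inj_onI, rule ccontr)
    fix u u' assume u: "u \<in> ?F" "u' \<in> ?F" "?o u = ?o u'" "u \<noteq> u'"
    then have "u \<subseteq> {1..n}" "u' \<subseteq> {1..n}" by (auto simp: face_def cube_def)
    then obtain j where j: "j \<in> symdiff u u'" "out u j \<noteq> out u' j"
      using sw u(4) unfolding szabo_welzl_def by blast
    have "symdiff u u' \<subseteq> symdiff u v \<union> symdiff u' v" by auto
    then have "j \<in> C" using u(1,2) j(1) by (auto simp: face_def)
    then show False using u(3) j(2) by blast
  qed
  have "?o ` ?F = Pow C"
  proof (rule card_subset_eq)
    show "finite (Pow C)" using C finite_subset by auto
    show "card (?o ` ?F) = card (Pow C)" using card_image[OF inj] card_face[OF v C] by simp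
  qed auto
  then have "{} \<in> ?o ` ?F" by simp
  then obtain u where u: "u \<in> ?F" "{} = ?o u" by (rule imageE)
  show "\<exists>!u. is_face_sink n out C v u"
  proof (rule ex1I[of _ u])
    show "is_face_sink n out C v u" using u unfolding is_face_sink_def by blast
    fix u' assume "is_face_sink n out C v u'"
    then have "u' \<in> ?F" "?o u' = ?o u"
      unfolding u(2)[symmetric] unfolding is_face_sink_def by blast+
    then show "u' = u" using inj u(1) by (auto dest: inj_onD)
  qed
qed

lemma potential_acyclic:
  assumes "potential {1..n} out p"
  shows "acyclic (edge_rel n out)"
proof -
  have "(edge_rel n out)\<inverse> \<subseteq> measure p"
    using assms by (auto simp: edge_rel_def potential_def cube_def)
  then have "acyclic ((edge_rel n out)\<inverse>)"
    using wf_acyclic wf_measure wf_subset by metis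
  then show ?thesis by (simp add: acyclic_converse)
qed

subsection \<open>Johnson's rule as a move-to-back rule\<close>

lemma set_move_back: "distinct L \<Longrightarrow> c \<in> set L \<Longrightarrow> set (move_back c L) = set L"
  by (auto simp: move_back_def)

lemma distinct_move_back: "distinct L \<Longrightarrow> distinct (move_back c L)"
  by (simp add: move_back_def)

lemma find_Some_mem: "find P L = Some c \<Longrightarrow> c \<in> set L \<and> P c"
  by (metis find_Some_iff nth_mem)

text \<open>The only direction that can be available at \<open>v\<close> on coordinate \<open>c\<close>; its \<open>h\<close>-value is the
  step of the last flip of \<open>c\<close> (\<open>0\<close> if there was none).\<close>
definition dir_at :: "nat set \<Rightarrow> nat \<Rightarrow> dir" where
  "dir_at v c = (if c \<in> v then Neg c else Pos c)"

definition key_less :: "nat set list \<Rightarrow> dir \<Rightarrow> dir \<Rightarrow> bool" where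
  "key_less vs d d' \<longleftrightarrow> hval vs d < hval vs d' \<or> (hval vs d = hval vs d' \<and> rank d < rank d')"

lemma available_iff:
  "available n out v d \<longleftrightarrow> (\<exists>c\<in>{1..n}. out v c \<and> d = dir_at v c)"
  by (cases d) (auto simp: available_def dir_at_def split: if_splits)

lemma move_dir_at: "move v (dir_at v c) = flip v c"
  by (auto simp: dir_at_def)

lemma Max_step:
  fixes N :: nat
  assumes "0 < N"
  shows "Max ({0} \<union> {y\<in>{1..N}. Q y}) =
    (if Q N then N else Max ({0} \<union> {y\<in>{1..N - 1}. Q y}))"
proof (cases "Q N")
  case True
  have "finite ({0} \<union> {y\<in>{1..N}. Q y})"
    by (rule finite_subset[of _ "{0..N}"]) auto
  moreover have "N \<in> {0} \<union> {y\<in>{1..N}. Q y}" using True assms by simp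
  ultimately have "Max ({0} \<union> {y\<in>{1..N}. Q y}) = N"
    by (intro Max_eqI) auto
  then show ?thesis using True by simp
next
  case False
  have "{y\<in>{1..N}. Q y} = {y\<in>{1..N - 1}. Q y}"
  proof (intro set_eqI iffI)
    fix y assume y: "y \<in> {y\<in>{1..N}. Q y}"
    then have "y \<noteq> N" using False by auto
    then show "y \<in> {y\<in>{1..N - 1}. Q y}" using y by auto
  qed auto
  then show ?thesis using False by simp
qed

lemma hval_le: "hval vs d \<le> length vs - 1"
  by (cases d) auto

lemma hval_snoc:
  assumes "vs \<noteq> []"
  shows "hval (vs @ [v]) (Pos c) = (if c \<in> last vs \<or> c \<in> v then length vs else hval vs (Pos c))"
    and "hval (vs @ [v]) (Neg c) = (if c \<notin> last vs \<or> c \<notin> v then length vs else hval vs (Neg c))"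
proof -
  have len: "0 < length vs" using assms by simp
  have nth: "(vs @ [v]) ! y = vs ! y" "(vs @ [v]) ! (y - 1) = vs ! (y - 1)"
    if "y \<in> {1..length vs - 1}" for y
    using that len by (auto simp: nth_append)
  have last: "(vs @ [v]) ! (length vs - 1) = last vs" "(vs @ [v]) ! length vs = v"
    using len by (simp_all add: nth_append last_conv_nth)
  have sets: "{y\<in>{1..length vs - 1}. R ((vs @ [v]) ! (y - 1)) ((vs @ [v]) ! y)}
      = {y\<in>{1..length vs - 1}. R (vs ! (y - 1)) (vs ! y)}" for R
    using nth by auto
  \<comment> \<open>\<open>R\<close> abstracts from the membership test, so that \<open>Pos\<close>
    and \<open>Neg\<close> become instances of one statement.\<close>
  note step = Max_step[OF len, of "\<lambda>y. R ((vs @ [v]) ! (y - 1)) ((vs @ [v]) ! y)" for R,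
      unfolded last sets]
  show "hval (vs @ [v]) (Pos c) = (if c \<in> last vs \<or> c \<in> v then length vs else hval vs (Pos c))"
    using step[of "\<lambda>a b. c \<in> a \<or> c \<in> b"] by (simp del: Max_insert)
  show "hval (vs @ [v]) (Neg c) = (if c \<notin> last vs \<or> c \<notin> v then length vs else hval vs (Neg c))"
    using step[of "\<lambda>a b. c \<notin> a \<or> c \<notin> b"] by (simp del: Max_insert)
qed

text \<open>The new direction at \<open>c\<close> counts the steps that touch the state just left,
  so its value is the current step, numbered \<open>length vs\<close> because the history starts
  with vertex 0. Elsewhere direction and value persist.\<close>

lemma hval_flip:
  assumes "vs \<noteq> []"
  shows "hval (vs @ [flip (last vs) c]) (dir_at (flip (last vs) c) d) =
    (if d = c then length vs else hval vs (dir_at (last vs) d))"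
  using hval_snoc[OF assms, of "flip (last vs) c" d] by (auto simp: dir_at_def simp del: hval.simps)

lemma key_less_flip:
  assumes "vs \<noteq> []" "key_less vs (dir_at (last vs) d) (dir_at (last vs) e)" "d \<noteq> c" "e \<noteq> c"
  shows "key_less (vs @ [flip (last vs) c])
    (dir_at (flip (last vs) c) d) (dir_at (flip (last vs) c) e)"
proof -
  have "dir_at (flip (last vs) c) d = dir_at (last vs) d"
    "dir_at (flip (last vs) c) e = dir_at (last vs) e"
    using assms(3,4) by (auto simp: dir_at_def)
  then show ?thesis
    using assms(2-) hval_flip[OF assms(1), of c d] hval_flip[OF assms(1), of c e]
    unfolding key_less_def by simp
qed

text \<open>Earlier values are at most \<open>length vs - 1\<close>, so the flipped coordinate gets
  the largest key whatever the ranks; this is why it moves to the back.\<close>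

lemma key_less_flipped:
  assumes "vs \<noteq> []" "d \<noteq> c"
  shows "key_less (vs @ [flip (last vs) c])
    (dir_at (flip (last vs) c) d) (dir_at (flip (last vs) c) c)"
proof -
  have "length vs - 1 < length vs" using assms(1) by simp
  then have "hval vs (dir_at (last vs) d) < length vs" by (meson hval_le le_less_trans)
  then show ?thesis
    using hval_flip[OF assms(1), of c d] hval_flip[OF assms(1), of c c] assms(2)
    unfolding key_less_def by simp
qed

lemma sorted_wrt_find:
  assumes "sorted_wrt R L" "find P L = Some c" "d \<in> set L" "P d" "d \<noteq> c"
  shows "R c d"
  using assms by (induction L) (auto split: if_splits)

text \<open>In a list sorted by key the first outgoing coordinate is minimal; asymmetry of
  \<open>key_less\<close> gives the uniqueness that \<open>THE\<close> requires.\<close>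

lemma johnson_choice_eq:
  assumes L: "set L = {1..n}"
    and sorted: "sorted_wrt (\<lambda>c d. key_less vs (dir_at (last vs) c) (dir_at (last vs) d)) L"
    and c: "find (out (last vs)) L = Some c"
  shows "johnson_choice n out vs = dir_at (last vs) c"
proof -
  let ?d = "dir_at (last vs) c"
  have av: "available n out (last vs) ?d"
    using find_Some_mem[OF c] L by (auto simp: available_iff)
  have min: "key_less vs ?d d'" if d': "available n out (last vs) d'" "d' \<noteq> ?d" for d'
  proof -
    obtain e where "e \<in> {1..n}" "out (last vs) e" "d' = dir_at (last vs) e"
      using d'(1) unfolding available_iff by blast
    moreover from this have "e \<noteq> c" using d'(2) by blast
    ultimately show ?thesis using sorted_wrt_find[OF sorted c] L by blast
  qed
  have "(THE d. available n out (last vs) d \<and>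
      (\<forall>d'. available n out (last vs) d' \<and> d' \<noteq> d \<longrightarrow> key_less vs d d')) = ?d"
  proof (rule the_equality)
    fix d assume d: "available n out (last vs) d \<and>
      (\<forall>d'. available n out (last vs) d' \<and> d' \<noteq> d \<longrightarrow> key_less vs d d')"
    show "d = ?d"
    proof (rule ccontr)
      assume "d \<noteq> ?d"
      then have "key_less vs d ?d" "key_less vs ?d d" using d av min by auto
      then show False by (auto simp: key_less_def)
    qed
  qed (use av min in auto)
  then show ?thesis by (simp add: johnson_choice_def key_less_def)
qed

text \<open>With \<open>q = (c - 1) div 4\<close>, the rank of \<open>Pos c\<close> is
  \<open>(c - 1) + 4 * q\<close>.\<close>

lemma rank_mono:
  assumes "c < d" "1 \<le> c"
  shows "rank (Pos c) < rank (Pos d)"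
proof -
  have "(c - 1) div 4 \<le> (d - 1) div 4" using assms by (simp add: div_le_mono)
  moreover have "c - 1 < d - 1" using assms by simp
  moreover have "4 * ((c - 1) div 4) + (c - 1) mod 4 = c - 1"
    "4 * ((d - 1) div 4) + (d - 1) mod 4 = d - 1" by simp_all
  ultimately show ?thesis unfolding rank.simps by linarith
qed

text \<open>The invariant is that the list stays sorted by key.\<close>

lemma johnson_lru:
  assumes "(lru_step out ^^ x) ({}, [1..<Suc n]) s"
  shows "last (johnson_hist n out {} x) = fst s \<and> johnson_hist n out {} x \<noteq> [] \<and>
    set (snd s) = {1..n} \<and> distinct (snd s) \<and>
    sorted_wrt (\<lambda>c d. key_less (johnson_hist n out {} x) (dir_at (fst s) c) (dir_at (fst s) d))
      (snd s)"
  using assms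
proof (induction x arbitrary: s)
  case 0
  \<comment> \<open>At \<open>{}\<close> all directions are positive and all values are 0, so the
    ranks decide, and they follow the numerical order.\<close>
  have "sorted_wrt (\<lambda>c d. key_less [{}] (dir_at {} c) (dir_at {} d)) [1..<Suc n]"
  proof (rule sorted_wrt_mono_rel[where P = "(<)"])
    fix c d assume "c \<in> set [1..<Suc n]" "c < d"
    then have "rank (Pos c) < rank (Pos d)" by (intro rank_mono) (simp_all only: set_upt atLeastLessThan_iff)
    then show "key_less [{}] (dir_at {} c) (dir_at {} d)"
      by (simp add: key_less_def dir_at_def del: rank.simps)
  qed (rule sorted_wrt_upt)
  then show ?case using 0 by (auto simp del: upt_Suc)
next
  case (Suc x)
  then obtain r where r: "(lru_step out ^^ x) ({}, [1..<Suc n]) r" "lru_step out r s"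
    by (auto simp: relcompp_apply)
  define vs where "vs = johnson_hist n out {} x"
  from Suc.IH[OF r(1)] have ih: "last vs = fst r" "vs \<noteq> []" "set (snd r) = {1..n}"
    "distinct (snd r)" "sorted_wrt (\<lambda>c d. key_less vs (dir_at (last vs) c) (dir_at (last vs) d)) (snd r)"
    unfolding vs_def by auto
  obtain c where c: "find (out (last vs)) (snd r) = Some c"
    and s: "s = (flip (last vs) c, move_back c (snd r))"
    using r(2) ih(1) unfolding lru_step_def by auto
  have mem: "c \<in> {1..n}" "out (last vs) c" using find_Some_mem[OF c] ih(3) by auto
  then have "johnson_next n out vs = flip (last vs) c"
    using johnson_choice_eq[of "snd r" n vs out c, OF ih(3,5) c] move_dir_at
    by (auto simp: johnson_next_def is_global_sink_def)
  then have hist: "johnson_hist n out {} (Suc x) = vs @ [flip (last vs) c]"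
    by (simp add: vs_def Let_def)
  have notin: "c \<notin> set (remove1 c (snd r))" using ih(4) by simp
  have "sorted_wrt (\<lambda>d e. key_less (vs @ [flip (last vs) c])
     (dir_at (flip (last vs) c) d) (dir_at (flip (last vs) c) e)) (move_back c (snd r))"
    unfolding move_back_def sorted_wrt_append
  proof (intro conjI ballI)
    have "sorted_wrt (\<lambda>d e. key_less vs (dir_at (last vs) d) (dir_at (last vs) e))
      (remove1 c (snd r))"
      using ih(4,5) by (simp add: distinct_remove1_removeAll removeAll_filter_not_eq sorted_wrt_filter)
    then show "sorted_wrt (\<lambda>d e. key_less (vs @ [flip (last vs) c])
        (dir_at (flip (last vs) c) d) (dir_at (flip (last vs) c) e)) (remove1 c (snd r))"
      by (rule sorted_wrt_mono_rel[rotated]) (metis notin key_less_flip[OF ih(2)])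
  qed (simp, metis notin key_less_flipped[OF ih(2)] empty_iff insert_iff list.set)
  then show ?case
    using ih mem(1) s by (simp only: hist) (simp add: set_move_back distinct_move_back)
qed

lemma johnson_not_sink:
  assumes "(lru_step out ^^ k) ({}, [1..<Suc n]) s" "x < k"
  shows "\<not> is_global_sink n out (johnson_vertex n out {} x)"
proof -
  have "k = x + Suc (k - x - 1)" using assms(2) by simp
  then have "((lru_step out ^^ x) OO (lru_step out ^^ Suc (k - x - 1))) ({}, [1..<Suc n]) s"
    using assms(1) by (metis relpowp_add)
  then obtain r where r: "(lru_step out ^^ x) ({}, [1..<Suc n]) r"
    "(lru_step out ^^ Suc (k - x - 1)) r s" by blast
  obtain r' where "lru_step out r r'" using r(2) by (metis relpowp_Suc_D2)
  then obtain c where "find (out (fst r)) (snd r) = Some c" by (auto simp: lru_step_def)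
  then show ?thesis
    using johnson_lru[OF r(1)] find_Some_mem
    unfolding johnson_vertex_def is_global_sink_def by metis
qed

subsection \<open>Extending an orientation by a frame\<close>

text \<open>The frame position is given relative to the frame sink \<open>f\<close>:
  \<open>D = {}\<close> is the sink.\<close>

definition join :: "nat set \<Rightarrow> nat set \<Rightarrow> nat set \<Rightarrow> nat set" where
  "join f v D = v \<union> symdiff f D"

text \<open>For \<open>x \<noteq> y\<close>, the uniform orientation towards \<open>{}\<close> with the \<open>x\<close>-edges reversed where
  \<open>y \<in> D\<close>: it contains the path \<open>{y}\<close>, \<open>{x, y}\<close>, \<open>{x}\<close>, \<open>{}\<close>.\<close>
definition twist :: "nat \<times> nat \<Rightarrow> nat set \<Rightarrow> nat \<Rightarrow> bool" where
  "twist p D j \<longleftrightarrow> (j \<in> D) \<noteq> (j = fst p \<and> fst p \<noteq> snd p \<and> snd p \<in> D)"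

definition extend :: "nat set \<Rightarrow> nat set \<Rightarrow> (nat set \<Rightarrow> nat \<times> nat) \<Rightarrow>
    (nat set \<Rightarrow> nat \<Rightarrow> bool) \<Rightarrow> (nat set \<Rightarrow> nat \<Rightarrow> bool) \<Rightarrow> nat set \<Rightarrow> nat \<Rightarrow> bool" where
  "extend S f g A B V j =
     (if j \<in> S then (if V - S = f then B else A) (V \<inter> S) j
      else twist (g (V \<inter> S)) (symdiff (V - S) f) j)"

lemma twist_empty [simp]: "\<not> twist p {} j"
  by (simp add: twist_def)

lemma join_Int: "v \<subseteq> S \<Longrightarrow> D \<inter> S = {} \<Longrightarrow> f \<inter> S = {} \<Longrightarrow> join f v D \<inter> S = v"
  by (auto simp: join_def)

lemma join_Diff: "v \<subseteq> S \<Longrightarrow> D \<inter> S = {} \<Longrightarrow> f \<inter> S = {} \<Longrightarrow> join f v D - S = symdiff f D"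
  by (auto simp: join_def)

lemma symdiff_cancel [simp]: "symdiff (symdiff f D) f = D"
  by auto

lemma symdiff_eq_left [simp]: "symdiff f D = f \<longleftrightarrow> D = {}"
  by (metis symdiff_cancel symdiff_empty symdiff_eq_empty)

lemma extend_join:
  assumes "v \<subseteq> S" "D \<inter> S = {}" "f \<inter> S = {}"
  shows "extend S f g A B (join f v D) j =
    (if j \<in> S then (if D = {} then B v j else A v j) else twist (g v) D j)"
  using join_Int[OF assms] join_Diff[OF assms] by (simp add: extend_def del: mem_symdiff)

lemma join_cases:
  assumes "V \<subseteq> S \<union> C" "f \<subseteq> C" "C \<inter> S = {}"
  obtains v D where "v \<subseteq> S" "D \<subseteq> C" "V = join f v D"
proof (rule that)
  show "V \<inter> S \<subseteq> S" by simp
  show "symdiff f (V - S) \<subseteq> C" using assms by auto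
  have "symdiff f (symdiff f (V - S)) = V - S" by auto
  then show "V = join f (V \<inter> S) (symdiff f (V - S))" unfolding join_def by auto
qed

lemma flip_join_inner:
  assumes "j \<in> S" "D \<inter> S = {}" "f \<inter> S = {}"
  shows "flip (join f v D) j = join f (flip v j) D"
proof -
  have "j \<notin> symdiff f D" using assms by auto
  then show ?thesis unfolding join_def by (auto simp del: mem_symdiff)
qed

lemma flip_join_frame:
  assumes "j \<notin> S" "v \<subseteq> S" "D \<inter> S = {}" "f \<inter> S = {}"
  shows "flip (join f v D) j = join f v (flip D j)"
proof -
  have "v \<inter> f = {}" "v \<inter> D = {}" "j \<notin> v" using assms by auto
  then show ?thesis unfolding join_def by auto
qed

text \<open>Away from \<open>fst p\<close> a twist is plain membership. If the positions differ in
  \<open>fst p\<close> only, they agree on \<open>snd p\<close>, so both or neither have the edge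
  reversed.\<close>

lemma twist_szabo_welzl:
  assumes "D \<noteq> D'"
  shows "\<exists>j\<in>symdiff D D'. twist p D j \<noteq> twist p D' j"
proof (cases "\<exists>j\<in>symdiff D D'. j \<noteq> fst p")
  case True
  then show ?thesis by (auto simp: twist_def)
next
  case False
  then have "symdiff D D' \<subseteq> {fst p}" by (auto simp del: mem_symdiff)
  moreover have "symdiff D D' \<noteq> {}" using assms by simp
  ultimately have eq: "symdiff D D' = {fst p}" by (simp add: subset_singleton_iff)
  have "twist p D (fst p) \<noteq> twist p D' (fst p)"
  proof (cases "fst p = snd p")
    case True
    have "fst p \<in> symdiff D D'" unfolding eq by simp
    then show ?thesis using True by (simp add: twist_def)
  next
    case False
    have "fst p \<in> symdiff D D'" "snd p \<notin> symdiff D D'" unfolding eq using False by auto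
    then show ?thesis by (auto simp: twist_def)
  qed
  then show ?thesis using eq by simp
qed

lemma symdiff_join:
  assumes "v \<subseteq> S" "v' \<subseteq> S" "D \<inter> S = {}" "D' \<inter> S = {}" "f \<inter> S = {}"
  shows "symdiff (join f v D) (join f v' D') = symdiff v v' \<union> symdiff D D'"
  using assms unfolding join_def symdiff_def by blast

text \<open>The frame orientations over all inner vertices share the sink \<open>f\<close>, and the face at \<open>f\<close>
  is therefore a hypersink, on which any orientation \<open>B\<close> is allowed.\<close>
lemma szabo_welzl_extend:
  assumes A: "szabo_welzl S A" and B: "szabo_welzl S B" and C: "f \<subseteq> C" "C \<inter> S = {}"
  shows "szabo_welzl (S \<union> C) (extend S f g A B)"
  unfolding szabo_welzl_def
proof (intro allI impI)
  fix V V' assume V: "V \<subseteq> S \<union> C" "V' \<subseteq> S \<union> C" "V \<noteq> V'"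
  obtain v D where v: "v \<subseteq> S" "D \<subseteq> C" "V = join f v D" by (rule join_cases[OF V(1) C])
  obtain v' D' where v': "v' \<subseteq> S" "D' \<subseteq> C" "V' = join f v' D'" by (rule join_cases[OF V(2) C])
  have disj: "D \<inter> S = {}" "D' \<inter> S = {}" "f \<inter> S = {}" using v v' C by auto
  note at = extend_join[OF v(1) disj(1,3)] extend_join[OF v'(1) disj(2,3)]
  have eq: "symdiff V V' = symdiff v v' \<union> symdiff D D'"
    using symdiff_join[OF v(1) v'(1) disj] v v' by simp
  \<comment> \<open>Equal inner vertices share one twist. Distinct ones either see the same inner
    orientation or have exactly one frame position at the sink.\<close>
  consider (inner) "v \<noteq> v'" "D = {} \<longleftrightarrow> D' = {}" | (frame) "v = v'" "D \<noteq> D'"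
    | (sink) "D \<noteq> D'" "D = {} \<or> D' = {}"
    using V(3) v v' by blast
  then show "\<exists>j\<in>symdiff V V'. extend S f g A B V j \<noteq> extend S f g A B V' j"
  proof cases
    case inner
    have sub: "symdiff v v' \<subseteq> S" using v v' by auto
    have "szabo_welzl S (if D = {} then B else A)" using A B by simp
    then obtain j where j: "j \<in> symdiff v v'"
      "(if D = {} then B else A) v j \<noteq> (if D = {} then B else A) v' j"
      using v(1) v'(1) inner(1) unfolding szabo_welzl_def by blast
    moreover from this have "j \<in> S" using sub by blast
    ultimately have "extend S f g A B V j \<noteq> extend S f g A B V' j"
      unfolding v(3) v'(3) at using inner(2) by (simp split: if_splits)
    then show ?thesis unfolding eq using j(1) by blast
  next
    case frame
    obtain j where j: "j \<in> symdiff D D'" "twist (g v) D j \<noteq> twist (g v) D' j"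
      using twist_szabo_welzl[OF frame(2)] by blast
    moreover from this have "j \<notin> S" using disj by auto
    ultimately have "extend S f g A B V j \<noteq> extend S f g A B V' j"
      unfolding v(3) v'(3) at using frame(1) by simp
    then show ?thesis unfolding eq using j(1) by blast
  next
    case sink
    \<comment> \<open>All twists agree on \<open>{}\<close>, so the pair belonging to the nonempty
      position can be used on both sides.\<close>
    have "\<exists>j\<in>symdiff D D'. twist (g v) D j \<noteq> twist (g v') D' j"
      using twist_szabo_welzl[OF sink(1), of "g v"] twist_szabo_welzl[OF sink(1), of "g v'"] sink(2)
      by (elim disjE) (simp_all del: mem_symdiff)
    then obtain j where j: "j \<in> symdiff D D'" "twist (g v) D j \<noteq> twist (g v') D' j" by blast
    moreover from this have "j \<notin> S" using disj by auto
    ultimately have "extend S f g A B V j \<noteq> extend S f g A B V' j"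
      unfolding v(3) v'(3) at by simp
    then show ?thesis unfolding eq using j(1) by blast
  qed
qed

section \<open>Acyclicity of the extension\<close>

definition twist_pot :: "nat \<times> nat \<Rightarrow> nat set \<Rightarrow> nat" where
  "twist_pot p D = 2 * card (D - {fst p}) + of_bool (twist p D (fst p))"

text \<open>A move on \<open>fst p\<close> clears the indicator; any other move removes an element
  of weight 2, which outweighs a newly set indicator.\<close>

lemma twist_pot_less:
  assumes "finite D" "twist p D j"
  shows "twist_pot p (flip D j) < twist_pot p D"
proof (cases "j = fst p")
  case True
  then have "flip D j - {fst p} = D - {fst p}" by auto
  moreover have "\<not> twist p (flip D j) (fst p)" using assms(2) True by (auto simp: twist_def)
  ultimately show ?thesis using assms(2) True by (simp add: twist_pot_def)
next
  case False
  then have j: "j \<in> D - {fst p}" using assms(2) by (auto simp: twist_def)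
  then have "flip D j - {fst p} = (D - {fst p}) - {j}" by auto
  then have "card (D - {fst p}) = Suc (card (flip D j - {fst p}))"
    using card.remove[of "D - {fst p}" j] j assms(1) by simp
  then show ?thesis unfolding twist_pot_def by (simp add: of_bool_def)
qed

lemma twist_pot_le:
  assumes "finite C" "D \<subseteq> C"
  shows "twist_pot p D \<le> 2 * card C + 1"
proof -
  have "card (D - {fst p}) \<le> card C" using assms by (intro card_mono) auto
  then show ?thesis by (simp add: twist_pot_def of_bool_def)
qed

text \<open>A lexicographic order coded in one number. The inner potential must dominate the frame,
  since an inner move can change the pair \<open>g v\<close> and thereby raise
  \<open>twist_pot\<close>.\<close>

lemma potential_extend:
  assumes A: "potential S A pA" and B: "potential S B pB" and C: "f \<subseteq> C" "C \<inter> S = {}"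
    and fin: "finite S" "finite C"
  shows "\<exists>p. potential (S \<union> C) (extend S f g A B) p"
proof -
  \<comment> \<open>\<open>K\<close> exceeds all values of \<open>pB\<close> on the inner cube and
    \<open>M\<close> all values of \<open>twist_pot\<close> on the frame.\<close>
  define K where "K = Suc (Max (pB ` Pow S))"
  define M where "M = 2 * card C + 2"
  define q where "q v D = (if D = {} then pB v else K + M * pA v + twist_pot (g v) D)" for v D
  define p where "p V = q (V \<inter> S) (symdiff (V - S) f)" for V
  have p_join: "p (join f v D) = q v D" if "v \<subseteq> S" "D \<subseteq> C" for v D
  proof -
    have disj: "D \<inter> S = {}" "f \<inter> S = {}" using that C by auto
    show ?thesis using join_Int[OF that(1) disj] join_Diff[OF that(1) disj] by (simp add: p_def)
  qed
  have K: "pB v < K" if "v \<subseteq> S" for v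
    unfolding K_def less_Suc_eq_le using that fin by (intro Max_ge) auto
  have "potential (S \<union> C) (extend S f g A B) p"
    unfolding potential_def
  proof (intro allI impI)
    fix V j assume V: "V \<subseteq> S \<union> C" and j: "j \<in> S \<union> C" and out: "extend S f g A B V j"
    obtain v D where v: "v \<subseteq> S" "D \<subseteq> C" "V = join f v D" by (rule join_cases[OF V C])
    have disj: "D \<inter> S = {}" "f \<inter> S = {}" using v C by auto
    have finD: "finite D" using v fin finite_subset by blast
    note out = out[unfolded v(3) extend_join[OF v(1) disj]]
    show "p (flip V j) < p V"
    proof (cases "j \<in> S")
      case True
      have sub: "flip v j \<subseteq> S" using flip_subset v True by blast
      have fl: "flip V j = join f (flip v j) D"
        using flip_join_inner[OF True disj] v by simp
      have p: "p (flip V j) = q (flip v j) D" "p V = q v D"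
        by (rule p_join[OF sub v(2), folded fl], rule p_join[OF v(1,2), folded v(3)])
      show ?thesis
      proof (cases "D = {}")
        case True
        then have "B v j" using out \<open>j \<in> S\<close> by simp
        then have "pB (flip v j) < pB v" using B v(1) \<open>j \<in> S\<close> by (simp add: potential_def)
        then show ?thesis unfolding p using True by (simp add: q_def)
      next
        case False
        then have "A v j" using out \<open>j \<in> S\<close> by simp
        then have "pA (flip v j) < pA v" using A v(1) \<open>j \<in> S\<close> by (simp add: potential_def)
        then have "M * pA (flip v j) + M \<le> M * pA v"
          by (metis Suc_leI add.commute mult_Suc_right mult_le_mono2)
        moreover have "twist_pot (g (flip v j)) D < M"
          using twist_pot_le[OF fin(2) v(2), of "g (flip v j)"] unfolding M_def by simp
        ultimately show ?thesis unfolding p using False by (simp add: q_def)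
      qed
    next
      case False
      have sub: "flip D j \<subseteq> C" using flip_subset[OF v(2)] j False by blast
      have fl: "flip V j = join f v (flip D j)"
        using flip_join_frame[OF False v(1) disj] v by simp
      have p: "p (flip V j) = q v (flip D j)" "p V = q v D"
        by (rule p_join[OF v(1) sub, folded fl], rule p_join[OF v(1,2), folded v(3)])
      have tw: "twist (g v) D j" using out False by simp
      moreover from this have "D \<noteq> {}" by auto
      ultimately show ?thesis
        using twist_pot_less[OF finD tw] K[OF v(1)]
        unfolding p by (simp add: q_def)
    qed
  qed
  then show ?thesis by blast
qed

subsection \<open>The run on an extended orientation\<close>

lemma find_append: "find P (xs @ ys) = (case find P xs of None \<Rightarrow> find P ys | Some x \<Rightarrow> Some x)"
  by (induction xs) auto

lemma find_remove1: "\<not> P c \<Longrightarrow> find P (remove1 c L) = find P L"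
  by (induction L) auto

lemma find_move_back: "\<not> P c \<Longrightarrow> find P (move_back c L) = find P L"
  by (simp add: move_back_def find_append find_remove1 split: option.splits)

lemma filter_move_back:
  "filter Q (move_back c L) = (if Q c then move_back c (filter Q L) else filter Q L)"
  by (simp add: move_back_def filter_remove1 remove1_idem)

lemma find_filter: "find (\<lambda>j. Q j \<and> P j) L = find P (filter Q L)"
  by (induction L) auto

lemma find_filter_Some: "find P L = Some c \<Longrightarrow> Q c \<Longrightarrow> find P (filter Q L) = Some c"
  by (induction L) (auto split: if_splits)

text \<open>\<open>a\<close> heads the frame coordinates, hence does not come after
  \<open>b\<close>, and no inner coordinate before \<open>b\<close> is accepted.\<close>

lemma find_frame_first:
  assumes "filter (\<lambda>j. j \<notin> S) L = a # r" "b \<notin> S" "find P L = Some b"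
    and "\<And>j. j \<in> S \<Longrightarrow> Q j = P j" "Q a"
  shows "find Q L = Some a"
  using assms by (induction L) (auto split: if_splits)

lemma lru_stepI:
  "find (out v) L = Some c \<Longrightarrow> w = flip v c \<Longrightarrow> M = move_back c L \<Longrightarrow> lru_step out (v, L) (w, M)"
  by (simp add: lru_step_def)

lemma relpowp_trans: "(R ^^ k) x y \<Longrightarrow> (R ^^ l) y z \<Longrightarrow> (R ^^ (k + l)) x z"
  by (auto simp: relpowp_add)

section \<open>The frame along a run of the inner orientation\<close>

text \<open>With the frame at \<open>{b}\<close>, \<open>b\<close> its second listed coordinate,
  this is the flip that would come next if the frame were oriented uniformly towards its
  sink.\<close>

definition next_choice :: "nat set \<Rightarrow> (nat set \<Rightarrow> nat \<Rightarrow> bool) \<Rightarrow> nat set \<Rightarrow> nat list \<Rightarrow> nat" where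
  "next_choice S A v L =
     the (find (\<lambda>j. if j \<in> S then A v j else j = filter (\<lambda>j. j \<notin> S) L ! 1) L)"

text \<open>If the next choice is inner, the pair yields the uniform frame orientation and the inner
  flip happens at once. If it is \<open>b\<close>, the uniform frame would fall into its sink; the
  twist diverts it via \<open>{a, b}\<close> to \<open>{a}\<close>.\<close>

definition twist_pair ::
    "nat set \<Rightarrow> (nat set \<Rightarrow> nat \<Rightarrow> bool) \<Rightarrow> nat set \<Rightarrow> nat list \<Rightarrow> nat \<times> nat" where
  "twist_pair S A v L = (filter (\<lambda>j. j \<notin> S) L ! 0, next_choice S A v L)"

text \<open>One step of \<open>A\<close> with the frame moves that precede it. The frame position is
  implied by the list: it is the singleton of the second listed frame coordinate.\<close>

definition macro_step ::
    "nat set \<Rightarrow> (nat set \<Rightarrow> nat \<Rightarrow> bool) \<Rightarrow> nat set \<times> nat list \<Rightarrow> nat set \<times> nat list" where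
  "macro_step S A s = (let v = fst s; L = snd s; F = filter (\<lambda>j. j \<notin> S) L;
     i = the (find (A v) (filter (\<lambda>j. j \<in> S) L)) in
     (flip v i, move_back i
       (if next_choice S A v L \<in> S then L else move_back (F ! 1) (move_back (F ! 0) L))))"

text \<open>The third coordinate makes the detour repeatable: position \<open>{b}\<close> with frame
  order \<open>a, b, c\<close> turns into position \<open>{a}\<close> with order
  \<open>c, a, b\<close>, so the occupied coordinate is second again.\<close>

definition three_frame :: "nat set \<Rightarrow> nat list \<Rightarrow> bool" where
  "three_frame S L \<longleftrightarrow> distinct L \<and> length (filter (\<lambda>j. j \<notin> S) L) = 3"

lemma three_frameE:
  assumes "three_frame S L"
  obtains a b c where "filter (\<lambda>j. j \<notin> S) L = [a, b, c]" "a \<noteq> b" "a \<noteq> c" "b \<noteq> c"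
    "a \<notin> S" "b \<notin> S" "c \<notin> S" "a \<in> set L" "b \<in> set L" "c \<in> set L" "distinct L"
proof -
  have "length (filter (\<lambda>j. j \<notin> S) L) = Suc (Suc (Suc 0))" "distinct L"
    using assms by (simp_all add: three_frame_def)
  then obtain a b c where F: "filter (\<lambda>j. j \<notin> S) L = [a, b, c]"
    by (auto simp: length_Suc_conv)
  moreover have "distinct [a, b, c]" using \<open>distinct L\<close> F by (metis distinct_filter)
  moreover have "set [a, b, c] = {j \<in> set L. j \<notin> S}" using F by (metis set_filter)
  ultimately show ?thesis using that[of a b c] \<open>distinct L\<close> by auto
qed

lemma three_frame_move_back:
  assumes "three_frame S L" "c \<in> set L"
  shows "three_frame S (move_back c L)"
proof -
  have "length (move_back c (filter (\<lambda>j. j \<notin> S) L)) = length (filter (\<lambda>j. j \<notin> S) L)"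
    if "c \<notin> S"
    using that assms(2) length_pos_if_in_set[of c "filter (\<lambda>j. j \<notin> S) L"]
    by (simp add: move_back_def length_remove1)
  then show ?thesis
    using assms by (auto simp: three_frame_def filter_move_back distinct_move_back)
qed

text \<open>Moving frame coordinates back leaves the inner sublist unchanged, so macro steps project
  onto steps of \<open>A\<close>.\<close>

lemma macro_step_props:
  assumes L: "three_frame S (snd s)"
    and step: "lru_step A (fst s, filter (\<lambda>j. j \<in> S) (snd s)) r"
  shows "fst (macro_step S A s) = fst r"
    and "filter (\<lambda>j. j \<in> S) (snd (macro_step S A s)) = snd r"
    and "three_frame S (snd (macro_step S A s))"
proof -
  obtain a b c where F: "filter (\<lambda>j. j \<notin> S) (snd s) = [a, b, c]" "a \<noteq> b" "a \<notin> S" "b \<notin> S"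
    "a \<in> set (snd s)" "b \<in> set (snd s)" "distinct (snd s)"
    using three_frameE[OF L] by metis
  obtain i where i: "find (A (fst s)) (filter (\<lambda>j. j \<in> S) (snd s)) = Some i"
    and r: "r = (flip (fst s) i, move_back i (filter (\<lambda>j. j \<in> S) (snd s)))"
    using step by (auto simp: lru_step_def)
  have iS: "i \<in> S" "i \<in> set (snd s)" using find_Some_mem[OF i] by auto
  define M where
    "M = (if next_choice S A (fst s) (snd s) \<in> S then snd s else move_back b (move_back a (snd s)))"
  have step_eq: "macro_step S A s = (flip (fst s) i, move_back i M)"
    by (simp add: macro_step_def Let_def i F M_def)
  have M: "three_frame S M" "set M = set (snd s)" "filter (\<lambda>j. j \<in> S) M = filter (\<lambda>j. j \<in> S) (snd s)"
    using F L by (auto simp: M_def three_frame_move_back set_move_back distinct_move_back filter_move_back)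
  show "fst (macro_step S A s) = fst r" using step_eq r by simp
  show "filter (\<lambda>j. j \<in> S) (snd (macro_step S A s)) = snd r"
    using step_eq r M iS by (simp add: filter_move_back)
  show "three_frame S (snd (macro_step S A s))"
    using step_eq M iS by (simp add: three_frame_move_back)
qed

text \<open>While the frame is at \<open>{b}\<close>, with \<open>b\<close> its second least recently flipped coordinate, it
  can make two moves that restore this situation without visiting its sink.\<close>
lemma dance:
  assumes F: "filter (\<lambda>j. j \<notin> S) L = [a, b, c]" "a \<noteq> b" "a \<notin> S" "b \<notin> S"
    and disj: "v \<subseteq> S" "f \<inter> S = {}"
    and g: "g v = (a, b)"
    and first: "find (\<lambda>j. if j \<in> S then A v j else j = b) L = Some b"
  shows "(lru_step (extend S f g A B) ^^ 2)
    (join f v {b}, L) (join f v {a}, move_back b (move_back a L))"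
proof -
  have at: "extend S f g A B (join f v {b}) = (\<lambda>j. if j \<in> S then A v j else j = a \<or> j = b)"
    "extend S f g A B (join f v {a, b}) = (\<lambda>j. if j \<in> S then A v j else j = b)"
    using F disj g by (auto simp: extend_join twist_def fun_eq_iff)
  have "lru_step (extend S f g A B) (join f v {b}, L) (join f v {a, b}, move_back a L)"
  proof (rule lru_stepI)
    show "find (extend S f g A B (join f v {b})) L = Some a"
      unfolding at by (rule find_frame_first[OF F(1,4) first]) (use F(3) in simp_all)
    have "flip {b} a = {a, b}" using F(2) by auto
    then show "join f v {a, b} = flip (join f v {b}) a"
      using flip_join_frame[of a S v "{b}" f] F disj by simp
  qed simp
  moreover have "lru_step (extend S f g A B) (join f v {a, b}, move_back a L)
      (join f v {a}, move_back b (move_back a L))"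
  proof (rule lru_stepI)
    show "find (extend S f g A B (join f v {a, b})) (move_back a L) = Some b"
      unfolding at using F first by (simp add: find_move_back)
    have "flip {a, b} b = {a}" using F(2) by auto
    then show "join f v {a} = flip (join f v {a, b}) b"
      using flip_join_frame[of b S v "{a, b}" f] F disj by simp
  qed simp
  ultimately show ?thesis by (auto simp: numeral_2_eq_2)
qed

text \<open>Only \<open>a\<close> is outgoing in the frame now, and it stands behind all inner
  coordinates, so an available inner flip comes first.\<close>

lemma find_after_dance:
  assumes "a \<notin> S" "b \<notin> S" "a \<noteq> b" "distinct L"
  shows "find (\<lambda>j. if j \<in> S then P j else j = a) (move_back b (move_back a L)) =
    (case find P (filter (\<lambda>j. j \<in> S) L) of None \<Rightarrow> Some a | Some i \<Rightarrow> Some i)"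
proof -
  have "find (\<lambda>j. if j \<in> S then P j else j = a) (remove1 a L)
      = find (\<lambda>j. j \<in> S \<and> P j) (remove1 a L)"
    using assms by (intro find_cong) auto
  also have "\<dots> = find P (filter (\<lambda>j. j \<in> S) L)"
    using assms(1) by (simp add: find_filter filter_remove1 remove1_idem)
  finally have *: "find (\<lambda>j. if j \<in> S then P j else j = a) (remove1 a L)
    = find P (filter (\<lambda>j. j \<in> S) L)" .
  have "find (\<lambda>j. if j \<in> S then P j else j = a) (move_back b (move_back a L))
      = find (\<lambda>j. if j \<in> S then P j else j = a) (move_back a L)"
    using assms by (intro find_move_back) simp
  also have "\<dots> = (case find P (filter (\<lambda>j. j \<in> S) L) of
      None \<Rightarrow> find (\<lambda>j. if j \<in> S then P j else j = a) [a] | Some i \<Rightarrow> Some i)"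
    unfolding move_back_def find_append * ..
  also have "find (\<lambda>j. if j \<in> S then P j else j = a) [a] = Some a" using assms(1) by simp
  finally show ?thesis .
qed

lemma macro_step_run:
  assumes L: "three_frame S L" and disj: "v \<subseteq> S" "f \<inter> S = {}"
    and step: "lru_step A (v, filter (\<lambda>j. j \<in> S) L) r"
    and g: "g v = twist_pair S A v L"
    and macro: "macro_step S A (v, L) = (v', L')"
  shows "\<exists>k\<ge>1. (lru_step (extend S f g A B) ^^ k)
    (join f v {filter (\<lambda>j. j \<notin> S) L ! 1}, L) (join f v' {filter (\<lambda>j. j \<notin> S) L' ! 1}, L')"
proof -
  obtain a b c where F: "filter (\<lambda>j. j \<notin> S) L = [a, b, c]" "a \<noteq> b" "a \<noteq> c" "b \<noteq> c"
    "a \<notin> S" "b \<notin> S" "c \<notin> S" "a \<in> set L" "b \<in> set L" "c \<in> set L" "distinct L"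
    using three_frameE[OF L] by metis
  obtain i where i: "find (A v) (filter (\<lambda>j. j \<in> S) L) = Some i"
    using step by (auto simp: lru_step_def)
  have iS: "i \<in> S" "i \<in> set L" using find_Some_mem[OF i] by auto
  let ?P = "\<lambda>j. if j \<in> S then A v j else j = b"
  obtain q where q: "find ?P L = Some q"
  proof (cases "find ?P L")
    case None
    then show ?thesis using F by (auto simp: find_None_iff split: if_splits)
  qed (use that in blast)
  have nth: "[a, b, c] ! 1 = b" by simp
  have choice: "next_choice S A v L = q"
    unfolding next_choice_def F(1) nth q by (rule option.sel)
  have g: "g v = (a, q)" using g F(1) choice by (simp add: twist_pair_def)
  have v': "v' = flip v i" using macro i by (auto simp: macro_step_def Let_def)
  show ?thesis
  \<comment> \<open>An inner choice takes one move; otherwise two frame moves precede the inner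
    flip, three moves in all.\<close>
  proof (cases "q \<in> S")
    case True
    have "find ?P (filter (\<lambda>j. j \<in> S) L) = Some q" by (rule find_filter_Some[of ?P L q "\<lambda>j. j \<in> S", OF q True])
    moreover have "find ?P (filter (\<lambda>j. j \<in> S) L) = find (A v) (filter (\<lambda>j. j \<in> S) L)"
      by (rule find_cong) auto
    ultimately have qi: "q = i" using i by simp
    have L': "L' = move_back i L"
      using macro i choice True by (auto simp: macro_step_def Let_def)
    have "extend S f g A B (join f v {b}) = ?P"
      using F disj g True by (auto simp: extend_join twist_def fun_eq_iff)
    then have "lru_step (extend S f g A B) (join f v {b}, L) (join f v' {b}, L')"
      using q qi L' v' flip_join_inner[OF iS(1), of "{b}" f v] F disj
      by (intro lru_stepI) auto
    then show ?thesis
      using F iS by (intro exI[of _ 1]) (simp add: L' filter_move_back eq_OO)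
  next
    case False
    then have qb: "q = b" using find_Some_mem[OF q] by simp
    have L': "L' = move_back i (move_back b (move_back a L))"
      using macro i choice False F by (auto simp: macro_step_def Let_def)
    have F': "filter (\<lambda>j. j \<notin> S) L' = [c, a, b]"
      using F iS by (simp add: L' filter_move_back) (simp add: move_back_def)
    have "extend S f g A B (join f v {a}) = (\<lambda>j. if j \<in> S then A v j else j = a)"
      using F disj g qb by (auto simp: extend_join twist_def fun_eq_iff)
    then have "lru_step (extend S f g A B) (join f v {a}, move_back b (move_back a L)) (join f v' {a}, L')"
      using find_after_dance[of a S b L "A v"] i L' v' flip_join_inner[OF iS(1), of "{a}" f v] F disj
      by (intro lru_stepI) auto
    moreover have "(lru_step (extend S f g A B) ^^ 2)
        (join f v {b}, L) (join f v {a}, move_back b (move_back a L))"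
      using F disj g q qb by (intro dance) auto
    ultimately have "(lru_step (extend S f g A B) ^^ Suc 2) (join f v {b}, L) (join f v' {a}, L')"
      by (metis relpowp_Suc_I)
    then show ?thesis
      using F F' by (intro exI[of _ "Suc 2"]) simp
  qed
qed

text \<open>At the sink of \<open>A\<close> no inner coordinate competes, so the two moves of
  \<open>dance\<close> are followed by the move from \<open>{a}\<close> into the frame sink.\<close>

lemma final_run:
  assumes L: "three_frame S L" and disj: "v \<subseteq> S" "f \<inter> S = {}"
    and sink: "\<forall>j\<in>S. \<not> A v j"
    and g: "g v = twist_pair S A v L"
  shows "\<exists>L'. filter (\<lambda>j. j \<in> S) L' = filter (\<lambda>j. j \<in> S) L \<and>
    (lru_step (extend S f g A B) ^^ 3)
      (join f v {filter (\<lambda>j. j \<notin> S) L ! 1}, L) (join f v {}, L')"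
proof -
  obtain a b c where F: "filter (\<lambda>j. j \<notin> S) L = [a, b, c]" "a \<noteq> b"
    "a \<notin> S" "b \<notin> S" "a \<in> set L" "b \<in> set L" "distinct L"
    using three_frameE[OF L] by metis
  let ?P = "\<lambda>j. if j \<in> S then A v j else j = b"
  have q: "find ?P L = Some b"
  proof (cases "find ?P L")
    case None
    then show ?thesis using F by (auto simp: find_None_iff split: if_splits)
  next
    case (Some q)
    then show ?thesis using find_Some_mem[OF Some] sink by (auto split: if_splits)
  qed
  have nth: "[a, b, c] ! 1 = b" by simp
  have g: "g v = (a, b)"
    using g unfolding twist_pair_def next_choice_def F(1) nth q by simp
  have at: "extend S f g A B (join f v {a}) = (\<lambda>j. if j \<in> S then A v j else j = a)"
    using F disj g by (auto simp: extend_join twist_def fun_eq_iff)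
  have none: "find (A v) (filter (\<lambda>j. j \<in> S) L) = None"
    using sink by (auto simp: find_None_iff)
  define M where "M = move_back b (move_back a L)"
  have flip_a: "flip {a} a = {}" by auto
  have "lru_step (extend S f g A B) (join f v {a}, M) (join f v {}, move_back a M)"
    using find_after_dance[of a S b L "A v"] F none at flip_join_frame[of a S v "{a}" f] disj flip_a
    by (intro lru_stepI) (auto simp: M_def)
  moreover have "(lru_step (extend S f g A B) ^^ 2) (join f v {b}, L) (join f v {a}, M)"
    unfolding M_def using F disj g q by (intro dance) auto
  ultimately have "(lru_step (extend S f g A B) ^^ Suc 2) (join f v {b}, L) (join f v {}, move_back a M)"
    by (metis relpowp_Suc_I)
  then show ?thesis
    using F by (intro exI[of _ "move_back a M"])
      (auto simp: M_def set_move_back distinct_move_back filter_move_back)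
qed

text \<open>Over the frame sink no frame coordinate is outgoing, so the search effectively sees the
  inner sublist only.\<close>

lemma sink_face_run:
  assumes "(lru_step B ^^ k) (v, filter (\<lambda>j. j \<in> S) L) r" "v \<subseteq> S" "f \<inter> S = {}"
  shows "fst r \<subseteq> S \<and> (\<exists>L'. filter (\<lambda>j. j \<in> S) L' = snd r \<and>
    (lru_step (extend S f g A B) ^^ k) (join f v {}, L) (join f (fst r) {}, L'))"
  using assms(1)
proof (induction k arbitrary: r)
  case 0
  then show ?case using assms(2) by auto
next
  case (Suc k)
  then obtain s where s: "(lru_step B ^^ k) (v, filter (\<lambda>j. j \<in> S) L) s" "lru_step B s r"
    by (auto simp: relcompp_apply)
  from Suc.IH[OF s(1)] obtain M where M: "fst s \<subseteq> S" "filter (\<lambda>j. j \<in> S) M = snd s"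
    "(lru_step (extend S f g A B) ^^ k) (join f v {}, L) (join f (fst s) {}, M)" by blast
  obtain i where i: "find (B (fst s)) (filter (\<lambda>j. j \<in> S) M) = Some i"
    and r: "r = (flip (fst s) i, move_back i (snd s))"
    using s(2) M(2) by (auto simp: lru_step_def)
  have iS: "i \<in> S" using find_Some_mem[OF i] by auto
  have "extend S f g A B (join f (fst s) {}) = (\<lambda>j. j \<in> S \<and> B (fst s) j)"
    using M(1) assms(3) by (auto simp: extend_join fun_eq_iff)
  then have "lru_step (extend S f g A B) (join f (fst s) {}, M) (join f (fst r) {}, move_back i M)"
    using i r find_filter[of "\<lambda>j. j \<in> S" "B (fst s)" M] flip_join_inner[OF iS, of "{}" f "fst s"] assms(3)
    by (intro lru_stepI) auto
  then have "(lru_step (extend S f g A B) ^^ Suc k) (join f v {}, L) (join f (fst r) {}, move_back i M)"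
    using M(3) by (metis relpowp_Suc_I)
  moreover have "fst r \<subseteq> S" using r M(1) iS by auto
  moreover have "filter (\<lambda>j. j \<in> S) (move_back i M) = snd r"
    using r M(2) iS by (simp add: filter_move_back)
  ultimately show ?case by blast
qed

text \<open>Each step of \<open>A\<close> costs at least one move and the descent into the frame
  sink three. \<open>g\<close> depends on the run of \<open>A\<close> alone, since \<open>B\<close>
  acts only once the frame sink is reached.\<close>

lemma extension_run:
  assumes pot: "potential S A p" and disj: "v0 \<subseteq> S" "f \<inter> S = {}"
    and L: "three_frame S L" "filter (\<lambda>j. j \<in> S) L = ys"
    and run: "(lru_step A ^^ T) (v0, ys) (w, M)" and sink: "\<forall>j\<in>S. \<not> A w j"
  shows "\<exists>g. \<forall>B. \<exists>k L'. T + 3 \<le> k \<and> filter (\<lambda>j. j \<in> S) L' = M \<and>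
    (lru_step (extend S f g A B) ^^ k) (join f v0 {filter (\<lambda>j. j \<notin> S) L ! 1}, L) (join f w {}, L')"
proof -
  obtain \<sigma> where \<sigma>: "\<sigma> 0 = (v0, ys)" "\<sigma> T = (w, M)" "\<And>t. t < T \<Longrightarrow> lru_step A (\<sigma> t) (\<sigma> (Suc t))"
    using run unfolding relpowp_fun_conv by blast
  define \<tau> where "\<tau> t = (macro_step S A ^^ t) (v0, L)" for t
  have \<tau>_Suc: "\<tau> (Suc t) = macro_step S A (\<tau> t)" for t by (simp add: \<tau>_def)
  have inv: "fst (\<tau> t) = fst (\<sigma> t) \<and> filter (\<lambda>j. j \<in> S) (snd (\<tau> t)) = snd (\<sigma> t) \<and>
      three_frame S (snd (\<tau> t)) \<and> fst (\<tau> t) \<subseteq> S" if "t \<le> T" for t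
    using that
  proof (induction t)
    case 0
    then show ?case using \<sigma> L disj by (simp add: \<tau>_def)
  next
    case (Suc t)
    then have IH: "fst (\<tau> t) = fst (\<sigma> t)" "filter (\<lambda>j. j \<in> S) (snd (\<tau> t)) = snd (\<sigma> t)"
      "three_frame S (snd (\<tau> t))" "fst (\<tau> t) \<subseteq> S" by auto
    have step: "lru_step A (fst (\<tau> t), filter (\<lambda>j. j \<in> S) (snd (\<tau> t))) (\<sigma> (Suc t))"
      using \<sigma>(3)[of t] Suc.prems IH by simp
    then obtain i where "find (A (fst (\<tau> t))) (filter (\<lambda>j. j \<in> S) (snd (\<tau> t))) = Some i"
      "fst (\<sigma> (Suc t)) = flip (fst (\<tau> t)) i" by (auto simp: lru_step_def)
    moreover from this have "i \<in> S" using find_Some_mem by fastforce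
    ultimately have "fst (\<sigma> (Suc t)) \<subseteq> S" using flip_subset[OF IH(4)] by simp
    then show ?case
      using macro_step_props[OF IH(3) step] by (simp add: \<tau>_Suc)
  qed
  have step: "lru_step A (fst (\<tau> t), filter (\<lambda>j. j \<in> S) (snd (\<tau> t))) (\<sigma> (Suc t))" if "t < T" for t
    using \<sigma>(3)[OF that] inv[of t] that by simp
  have less: "p (fst (\<tau> (Suc t))) < p (fst (\<tau> t))" if t: "t < T" for t
  proof -
    obtain i where i: "find (A (fst (\<tau> t))) (filter (\<lambda>j. j \<in> S) (snd (\<tau> t))) = Some i"
      "fst (\<sigma> (Suc t)) = flip (fst (\<tau> t)) i" using step[OF t] by (auto simp: lru_step_def)
    have "i \<in> S" "A (fst (\<tau> t)) i" using find_Some_mem[OF i(1)] by auto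
    moreover have "fst (\<tau> t) \<subseteq> S" using inv[of t] t by auto
    ultimately have "p (flip (fst (\<tau> t)) i) < p (fst (\<tau> t))"
      using pot unfolding potential_def by blast
    then show ?thesis using i(2) inv[of "Suc t"] t by simp
  qed
  have decr: "p (fst (\<tau> t)) < p (fst (\<tau> s))" if "s < t" "t \<le> T" for s t
    using that
  proof (induction t)
    case (Suc t)
    then show ?case using less[of t] by (cases "s = t") (auto intro: less_trans)
  qed simp
  \<comment> \<open>\<open>g\<close> sees the vertex but not the list. As the potential decreases,
    each vertex of the run has a unique time up to \<open>T\<close>, which \<open>LEAST\<close>
    recovers. Off the run the value is arbitrary, as \<open>szabo_welzl_extend\<close> and
    \<open>potential_extend\<close> hold for every \<open>g\<close>.\<close>
  define g where "g v = twist_pair S A v (snd (\<tau> (LEAST t. fst (\<tau> t) = v)))" for v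
  have g: "g (fst (\<tau> t)) = twist_pair S A (fst (\<tau> t)) (snd (\<tau> t))" if t: "t \<le> T" for t
  proof -
    have "(LEAST u. fst (\<tau> u) = fst (\<tau> t)) = t"
    proof (rule Least_equality)
      fix u assume "fst (\<tau> u) = fst (\<tau> t)"
      then show "t \<le> u" using decr[of u t] t by (metis less_irrefl not_le)
    qed simp
    then show ?thesis by (simp add: g_def)
  qed
  have "\<exists>k L'. T + 3 \<le> k \<and> filter (\<lambda>j. j \<in> S) L' = M \<and>
    (lru_step (extend S f g A B) ^^ k) (join f v0 {filter (\<lambda>j. j \<notin> S) L ! 1}, L) (join f w {}, L')" for B
  proof -
    have "\<exists>k\<ge>t. (lru_step (extend S f g A B) ^^ k) (join f v0 {filter (\<lambda>j. j \<notin> S) L ! 1}, L)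
      (join f (fst (\<tau> t)) {filter (\<lambda>j. j \<notin> S) (snd (\<tau> t)) ! 1}, snd (\<tau> t))" if "t \<le> T" for t
      using that
    proof (induction t)
      case 0
      show ?case by (intro exI[of _ 0]) (simp add: \<tau>_def)
    next
      case (Suc t)
      then obtain k where k: "k \<ge> t"
        "(lru_step (extend S f g A B) ^^ k) (join f v0 {filter (\<lambda>j. j \<notin> S) L ! 1}, L)
          (join f (fst (\<tau> t)) {filter (\<lambda>j. j \<notin> S) (snd (\<tau> t)) ! 1}, snd (\<tau> t))" by auto
      have t: "t \<le> T" "t < T" using Suc.prems by auto
      have three: "three_frame S (snd (\<tau> t))" and sub: "fst (\<tau> t) \<subseteq> S"
        using inv[OF t(1)] by auto
      have macro: "macro_step S A (fst (\<tau> t), snd (\<tau> t)) = (fst (\<tau> (Suc t)), snd (\<tau> (Suc t)))"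
        by (simp add: \<tau>_Suc)
      obtain l where l: "l \<ge> 1" "(lru_step (extend S f g A B) ^^ l)
          (join f (fst (\<tau> t)) {filter (\<lambda>j. j \<notin> S) (snd (\<tau> t)) ! 1}, snd (\<tau> t))
          (join f (fst (\<tau> (Suc t))) {filter (\<lambda>j. j \<notin> S) (snd (\<tau> (Suc t))) ! 1}, snd (\<tau> (Suc t)))"
        using macro_step_run[where v = "fst (\<tau> t)" and L = "snd (\<tau> t)" and g = g and B = B,
            OF three sub disj(2) step[OF t(2)] g[OF t(1)] macro] by blast
      show ?case
        using relpowp_trans[OF k(2) l(2)] k(1) l(1) by (intro exI[of _ "k + l"]) simp
    qed
    then obtain k where k: "k \<ge> T" "(lru_step (extend S f g A B) ^^ k)
        (join f v0 {filter (\<lambda>j. j \<notin> S) L ! 1}, L)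
        (join f w {filter (\<lambda>j. j \<notin> S) (snd (\<tau> T)) ! 1}, snd (\<tau> T))"
      using inv[of T] \<sigma>(2) by auto
    obtain L' where L': "filter (\<lambda>j. j \<in> S) L' = filter (\<lambda>j. j \<in> S) (snd (\<tau> T))"
      "(lru_step (extend S f g A B) ^^ 3)
        (join f w {filter (\<lambda>j. j \<notin> S) (snd (\<tau> T)) ! 1}, snd (\<tau> T)) (join f w {}, L')"
      using final_run[of S "snd (\<tau> T)" w f A g B] inv[of T] \<sigma>(2) disj sink g[of T] by auto
    show ?thesis
      using relpowp_trans[OF k(2) L'(2)] k(1) L'(1) inv[of T] \<sigma>(2)
      by (intro exI[of _ "k + 3"] exI[of _ L']) simp
  qed
  then show ?thesis by blast
qed

section \<open>Doubling the run with three coordinates\<close>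

lemma lru_run_invariant:
  assumes "(lru_step A ^^ k) (v, xs) (w, M)" "v \<subseteq> set xs" "distinct xs"
  shows "w \<subseteq> set xs \<and> set M = set xs \<and> distinct M"
  using assms(1)
proof (induction k arbitrary: w M)
  case 0
  then show ?case using assms by simp
next
  case (Suc k)
  then obtain u N where "(lru_step A ^^ k) (v, xs) (u, N)" and step: "lru_step A (u, N) (w, M)"
    by (auto simp: relcompp_apply)
  then have u: "u \<subseteq> set xs" "set N = set xs" "distinct N" using Suc.IH by blast+
  obtain c where c: "find (A u) N = Some c" "w = flip u c" "M = move_back c N"
    using step by (auto simp: lru_step_def)
  have "c \<in> set N" using find_Some_mem[OF c(1)] by simp
  then show ?case
    using c u flip_subset by (simp add: set_move_back distinct_move_back)
qed

text \<open>The bound is \<open>k \<ge> 3 * 2 ^ m - 3\<close>, matching the recursion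
  \<open>k \<ge> T + 3 + U\<close>. Start and list are arbitrary because the second half begins
  where the first half ends.\<close>

lemma exists_long_run:
  assumes "3 * m \<le> length xs" "distinct xs" "v0 \<subseteq> set xs"
  shows "\<exists>out p k w M. szabo_welzl (set xs) out \<and> potential (set xs) out p \<and>
    3 * 2 ^ m \<le> k + 3 \<and> (lru_step out ^^ k) (v0, xs) (w, M) \<and> (\<forall>j\<in>set xs. \<not> out w j)"
  using assms
proof (induction m arbitrary: xs v0)
  case 0
  \<comment> \<open>The uniform orientation towards \<open>v0\<close>, with a run of length
    0.\<close>
  define out :: "nat set \<Rightarrow> nat \<Rightarrow> bool" where "out v j \<longleftrightarrow> j \<in> symdiff v v0" for v j
  have "szabo_welzl (set xs) out"
    by (auto simp: szabo_welzl_def out_def)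
  moreover have "potential (set xs) out (\<lambda>v. card (symdiff v v0))"
    unfolding potential_def
  proof (intro allI impI)
    fix v j assume v: "v \<subseteq> set xs" "out v j"
    have "symdiff (flip v j) v0 = symdiff v v0 - {j}" using v(2) by (auto simp: out_def)
    moreover have "finite (symdiff v v0)"
      using v(1) 0(3) finite_subset[OF v(1)] finite_subset[OF 0(3)] by (simp add: symdiff_def)
    ultimately show "card (symdiff (flip v j) v0) < card (symdiff v v0)"
      using v(2) unfolding out_def by (metis card_Diff1_less)
  qed
  moreover have "(lru_step out ^^ 0) (v0, xs) (v0, xs)" by simp
  moreover have "\<forall>j\<in>set xs. \<not> out v0 j" by (simp add: out_def)
  ultimately show ?case by fastforce
next
  case (Suc m)
  then obtain a b c ys where xs: "xs = a # b # c # ys"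
    by (cases xs; cases "tl xs"; cases "tl (tl xs)") auto
  \<comment> \<open>The first three listed coordinates form the frame, and \<open>f\<close> is
    placed such that \<open>v0\<close> has relative frame position \<open>{b}\<close>.\<close>
  define S C f where "S = set ys" and "C = {a, b, c}" and "f = symdiff (v0 \<inter> C) {b}"
  have ys: "3 * m \<le> length ys" "distinct ys" using Suc.prems xs by auto
  have C: "f \<subseteq> C" "C \<inter> S = {}" "set xs = S \<union> C" "f \<inter> S = {}"
    using Suc.prems(2) xs by (auto simp: S_def C_def f_def)
  have filt: "filter (\<lambda>j. j \<in> S) ys = ys" "filter (\<lambda>j. j \<notin> S) ys = []"
    by (auto simp: S_def filter_empty_conv)
  have fr: "filter (\<lambda>j. j \<notin> S) xs = [a, b, c]" "filter (\<lambda>j. j \<in> S) xs = ys"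
    using C filt by (auto simp: xs C_def)
  have three: "three_frame S xs" using fr Suc.prems(2) by (simp add: three_frame_def)
  have "symdiff f {b} = v0 \<inter> C" unfolding f_def by auto
  then have start: "join f (v0 \<inter> S) {b} = v0"
    using Suc.prems(3) C(3) by (auto simp: join_def)
  obtain A pA T w N where A: "szabo_welzl S A" "potential S A pA" "3 * 2 ^ m \<le> T + 3"
    "(lru_step A ^^ T) (v0 \<inter> S, ys) (w, N)" "\<forall>j\<in>S. \<not> A w j"
    using Suc.IH[OF ys, of "v0 \<inter> S"] unfolding S_def by auto
  obtain g where g: "\<forall>B. \<exists>k L'. T + 3 \<le> k \<and> filter (\<lambda>j. j \<in> S) L' = N \<and>
    (lru_step (extend S f g A B) ^^ k) (v0, xs) (join f w {}, L')"
    using extension_run[OF A(2) _ C(4) three fr(2) A(4,5)] fr(1) start by auto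
  have w: "w \<subseteq> S" and N: "set N = S" "distinct N"
    using lru_run_invariant[OF A(4) _ ys(2)] by (auto simp: S_def)
  then have "length N = length ys" using ys(2) unfolding S_def by (metis distinct_card)
  \<comment> \<open>Second use of the induction hypothesis, at the end vertex and the end list of
    the run of \<open>A\<close>.\<close>
  obtain B pB U z K where B: "szabo_welzl S B" "potential S B pB" "3 * 2 ^ m \<le> U + 3"
    "(lru_step B ^^ U) (w, N) (z, K)" "\<forall>j\<in>S. \<not> B z j"
    using Suc.IH[of N w] N w ys \<open>length N = length ys\<close> by auto
  obtain k L' where k: "T + 3 \<le> k" "filter (\<lambda>j. j \<in> S) L' = N"
    "(lru_step (extend S f g A B) ^^ k) (v0, xs) (join f w {}, L')"
    using g by blast
  obtain K' where z: "z \<subseteq> S"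
    "(lru_step (extend S f g A B) ^^ U) (join f w {}, L') (join f z {}, K')"
    using sink_face_run[where B = B and k = U and v = w and S = S and L = L' and r = "(z, K)"
        and f = f and g = g and A = A] B(4) k(2) w C(4) by auto
  have "szabo_welzl (set xs) (extend S f g A B)"
    unfolding C(3) using szabo_welzl_extend[OF A(1) B(1) C(1,2)] .
  moreover obtain p where "potential (set xs) (extend S f g A B) p"
    unfolding C(3) using potential_extend[OF A(2) B(2) C(1,2)] by (auto simp: S_def C_def)
  moreover have "3 * 2 ^ Suc m \<le> (k + U) + 3" using A(3) B(3) k(1) by simp
  moreover have "(lru_step (extend S f g A B) ^^ (k + U)) (v0, xs) (join f z {}, K')"
    using relpowp_trans[OF k(3) z(2)] .
  moreover have "\<forall>j\<in>set xs. \<not> extend S f g A B (join f z {}) j"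
    using B(5) z(1) C(4) by (simp add: extend_join)
  ultimately show ?case by blast
qed

theorem theorem4:
  fixes n :: nat
  assumes "n > 0" and "4 dvd n"
  shows "\<exists>out v0. is_AUSO n out \<and> v0 \<in> cube n \<and>
           (\<forall>x < 2 ^ (n div 4). \<not> is_global_sink n out (johnson_vertex n out v0 x))"
proof -
  define m where "m = n div 4"
  have m: "0 < m" "3 * m \<le> n" using assms by (auto simp: m_def)
  obtain out p k w M where out: "szabo_welzl {1..n} out" "potential {1..n} out p"
    "3 * 2 ^ m \<le> k + 3" "(lru_step out ^^ k) ({}, [1..<Suc n]) (w, M)"
    using exists_long_run[of m "[1..<Suc n]" "{}"] m(2)
    by (auto simp: atLeastLessThanSuc_atLeastAtMost simp del: upt_Suc)
  \<comment> \<open>From \<open>2 ^ m \<ge> 2\<close> it follows that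
    \<open>3 * 2 ^ m - 3 \<ge> 2 ^ m\<close>.\<close>
  have "(2::nat) ^ 1 \<le> 2 ^ m" using m(1) by (intro power_increasing) auto
  then have "2 ^ m \<le> k" using out(3) by simp
  then have "\<forall>x < 2 ^ (n div 4). \<not> is_global_sink n out (johnson_vertex n out {} x)"
    using johnson_not_sink[OF out(4)] unfolding m_def by auto
  moreover have "is_AUSO n out"
    using szabo_welzl_is_USO[OF out(1)] potential_acyclic[OF out(2)] by (simp add: is_AUSO_def)
  moreover have "{} \<in> cube n" by (simp add: cube_def)
  ultimately show ?thesis by blast
qed

end
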